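(* Let $X$ be a real random variable with finite law $x_1<\cdots<x_n$, $p_i=\mathbb P(X=x_i)>0$, $\sum_{i=1}^n p_i=1$, $n\ge 2$, and mean $\mu=\mathbb E X$. Assume that for some $k$ $$x_k<\mu<x_{k+1},\qquad \mathbb P(X<\mu)=\mathbb P(X>\mu)=\tfrac12 ,$$ and that the signal $D_i:=R_i^2-L_i^2$ $(1\le i\le n)$, with $R_i,L_i$ as in the context, is nonincreasing in $i$. Put $$d:=\mathbb E[X-\mu\mid X>\mu]=\mathbb E[\mu-X\mid X<\mu],\quad z_-:=\mu-x_k,\quad z_+:=x_{k+1}-\mu,\quad p_-:=p_k,\quad p_+:=p_{k+1}.$$ Then the mean-gap cut (the cut after $x_k$) is globally optimal if and only if $$p_-\le\frac{d z_-}{d^2+z_-^2},\qquad p_+\le\frac{d z_+}{d^2+z_+^2},$$ where an inequality is omitted if the neighbouring two-regime cut is inadmissible (the left inequality is omitted if $k-1<1$, the right one if $k+1>n-1$). Strict inequalities (among those not omitted) together with a strictly decreasing signal $(D_i)$ give a unique optimal cut. Equality on one side makes the adjacent cut on that side (the cut after $x_{k-1}$ for the left inequality, the cut after $x_{k+1}$ for the right one) optimal as well; under a merely nonincreasing signal, a larger consecutive block of tied optimal cuts is possible.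
   Context: Put $P_i:=\sum_{j\le i}p_j$, $P_0:=0$, and $T_i:=\sum_{j\ge i}p_j=1-P_{i-1}$. For $1\le i<n$ the optimized squared risk at the cut after $x_i$ (the partition $\{X\le x_i\}\mid\{X>x_i\}$) is $$W_i:=\min_{a,b\in\mathbb R}\Big\{\sum_{j\le i}p_j(x_j-a)^2+\sum_{j>i}p_j(x_j-b)^2\Big\}.$$ The cut after $x_i$ is admissible when $1\le i\le n-1$ (both sides nonempty), and it is globally optimal if $W_i=\min_{1\le j<n}W_j$ (equivalently, its gain $\operatorname{Var}(X)-W_i$ is maximal). For $1\le i<n$ set $A_i:=\sum_{j>i}p_j(x_j-x_i)$ and $R_i:=A_i/\sqrt{T_iT_{i+1}}$; for $1<i\le n$ set $C_i:=\sum_{j<i}p_j(x_i-x_j)$ and $L_i:=C_i/\sqrt{P_{i-1}P_i}$; and $L_1:=0$, $R_n:=0$. *)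

theory Defs
  imports "HOL-Probability.Probability"
begin

text \<open>
  A finite law is given by its atoms \<open>x 1 < \<dots> < x n\<close> and weights \<open>p 1, \<dots>, p n\<close>;
  the values of \<open>x\<close> and \<open>p\<close> outside \<open>{1..n}\<close> are irrelevant.
\<close>

definition has_finite_law ::
    "'a measure \<Rightarrow> ('a \<Rightarrow> real) \<Rightarrow> nat \<Rightarrow> (nat \<Rightarrow> real) \<Rightarrow> (nat \<Rightarrow> real) \<Rightarrow> bool" where
  "has_finite_law M X n x p \<longleftrightarrow>
     prob_space M \<and> X \<in> borel_measurable M \<and> n \<ge> 2 \<and> strict_mono_on {1..n} x \<and>
     (\<forall>i\<in>{1..n}. p i = measure M {\<omega> \<in> space M. X \<omega> = x i} \<and> p i > 0) \<and>
     (\<Sum>i=1..n. p i) = 1"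

definition head_mass :: "(nat \<Rightarrow> real) \<Rightarrow> nat \<Rightarrow> real" where
  "head_mass p i = (\<Sum>j=1..i. p j)"

definition tail_mass :: "nat \<Rightarrow> (nat \<Rightarrow> real) \<Rightarrow> nat \<Rightarrow> real" where
  "tail_mass n p i = (\<Sum>j=i..n. p j)"

definition two_regime_risk ::
    "nat \<Rightarrow> (nat \<Rightarrow> real) \<Rightarrow> (nat \<Rightarrow> real) \<Rightarrow> nat \<Rightarrow> real \<Rightarrow> real \<Rightarrow> real" where
  "two_regime_risk n x p i a b =
     (\<Sum>j=1..i. p j * (x j - a)\<^sup>2) + (\<Sum>j\<in>{i<..n}. p j * (x j - b)\<^sup>2)"

text \<open>
  The minimum is attained for \<open>1 \<le> i < n\<close> and positive weights, at the means of the
  two sides, so \<open>LEAST\<close> is meaningful there.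
\<close>

definition optimized_risk :: "nat \<Rightarrow> (nat \<Rightarrow> real) \<Rightarrow> (nat \<Rightarrow> real) \<Rightarrow> nat \<Rightarrow> real" where
  "optimized_risk n x p i = (LEAST w. \<exists>a b. w = two_regime_risk n x p i a b)"

text \<open>A cut is identified with the index \<open>i\<close> of the last atom on its left side.\<close>

definition admissible_cut :: "nat \<Rightarrow> nat \<Rightarrow> bool" where
  "admissible_cut n i \<longleftrightarrow> 1 \<le> i \<and> i \<le> n - 1"

definition optimal_cut :: "nat \<Rightarrow> (nat \<Rightarrow> real) \<Rightarrow> (nat \<Rightarrow> real) \<Rightarrow> nat \<Rightarrow> bool" where
  "optimal_cut n x p i \<longleftrightarrow>
     admissible_cut n i \<and> optimized_risk n x p i = Min (optimized_risk n x p ` {1..<n})"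

definition signal_R :: "nat \<Rightarrow> (nat \<Rightarrow> real) \<Rightarrow> (nat \<Rightarrow> real) \<Rightarrow> nat \<Rightarrow> real" where
  "signal_R n x p i =
     (if i < n
      then (\<Sum>j\<in>{i<..n}. p j * (x j - x i)) / sqrt (tail_mass n p i * tail_mass n p (i + 1))
      else 0)"

definition signal_L :: "(nat \<Rightarrow> real) \<Rightarrow> (nat \<Rightarrow> real) \<Rightarrow> nat \<Rightarrow> real" where
  "signal_L x p i =
     (if 1 < i
      then (\<Sum>j=1..<i. p j * (x i - x j)) / sqrt (head_mass p (i - 1) * head_mass p i)
      else 0)"

definition signal_D :: "nat \<Rightarrow> (nat \<Rightarrow> real) \<Rightarrow> (nat \<Rightarrow> real) \<Rightarrow> nat \<Rightarrow> real" where
  "signal_D n x p i = (signal_R n x p i)\<^sup>2 - (signal_L x p i)\<^sup>2"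

abbreviation mean :: "'a measure \<Rightarrow> ('a \<Rightarrow> real) \<Rightarrow> real" where
  "mean M X \<equiv> integral\<^sup>L M X"

definition event_expectation :: "'a measure \<Rightarrow> 'a set \<Rightarrow> ('a \<Rightarrow> real) \<Rightarrow> real" where
  "event_expectation M S Y = (LINT \<omega>:S|M. Y \<omega>) / measure M S"

definition upper_deviation :: "'a measure \<Rightarrow> ('a \<Rightarrow> real) \<Rightarrow> real" where
  "upper_deviation M X =
     event_expectation M {\<omega> \<in> space M. X \<omega> > mean M X} (\<lambda>\<omega>. X \<omega> - mean M X)"

definition lower_deviation :: "'a measure \<Rightarrow> ('a \<Rightarrow> real) \<Rightarrow> real" where
  "lower_deviation M X =
     event_expectation M {\<omega> \<in> space M. X \<omega> < mean M X} (\<lambda>\<omega>. mean M X - X \<omega>)"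

definition balanced_mean_gap ::
    "'a measure \<Rightarrow> ('a \<Rightarrow> real) \<Rightarrow> nat \<Rightarrow> (nat \<Rightarrow> real) \<Rightarrow> nat \<Rightarrow> bool" where
  "balanced_mean_gap M X n x k \<longleftrightarrow>
     1 \<le> k \<and> k < n \<and> x k < mean M X \<and> mean M X < x (k + 1) \<and>
     measure M {\<omega> \<in> space M. X \<omega> < mean M X} = 1 / 2 \<and>
     measure M {\<omega> \<in> space M. X \<omega> > mean M X} = 1 / 2"

text \<open>The bounds \<open>d z / (d\<^sup>2 + z\<^sup>2)\<close> for the masses of the two atoms next to the mean.\<close>

definition mass_bound :: "real \<Rightarrow> real \<Rightarrow> real" where
  "mass_bound d z = d * z / (d\<^sup>2 + z\<^sup>2)"

definition left_bound :: "'a measure \<Rightarrow> ('a \<Rightarrow> real) \<Rightarrow> (nat \<Rightarrow> real) \<Rightarrow> nat \<Rightarrow> real" where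
  "left_bound M X x k = mass_bound (upper_deviation M X) (mean M X - x k)"

definition right_bound :: "'a measure \<Rightarrow> ('a \<Rightarrow> real) \<Rightarrow> (nat \<Rightarrow> real) \<Rightarrow> nat \<Rightarrow> real" where
  "right_bound M X x k = mass_bound (upper_deviation M X) (x (k + 1) - mean M X)"

end

theory Submission
  imports Defs
begin

text \<open>
  Merging the atom \<open>x i\<close> with everything to its left raises the within-group sum of squares
  by \<open>p i * L i\<^sup>2\<close>, merging it with everything to its right raises it by \<open>p i * R i\<^sup>2\<close>. Hence
  \<open>W (i - 1) - W i = p i * D i\<close>, and if \<open>D\<close> is nonincreasing, then \<open>W\<close> first falls and
  then rises, so a cut is optimal as soon as it beats its two neighbours. The gain of a cut
  is \<open>S\<^sup>2 / (P * (1 - P))\<close> with \<open>P\<close> the mass and \<open>S\<close> the absolute first moment about the mean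
  on its left side. For the balanced cut this is \<open>d\<^sup>2\<close>, for a neighbour separated from it by an
  atom of mass \<open>p\<close> at distance \<open>z\<close> from the mean it is \<open>(d/2 - p z)\<^sup>2 / (1/4 - p\<^sup>2)\<close>, and
  comparing the two gives the mass bounds. If \<open>D\<close> vanishes at all interior atoms, then all
  cuts are tied; the law with atoms \<open>-9, -3, -1, 3\<close> and masses \<open>1/10, 1/10, 3/10, 1/2\<close> and its
  reflection are of this kind.
\<close>

section \<open>Centred moments and the optimized risk of a cut\<close>

text \<open>When \<open>m\<close> is the mean, the centred moment of the left side is the negative
  of this one, so a single quantity describes both sides of a cut.\<close>

definition upper_moment ::
    "nat \<Rightarrow> (nat \<Rightarrow> real) \<Rightarrow> (nat \<Rightarrow> real) \<Rightarrow> real \<Rightarrow> nat \<Rightarrow> real" where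
  "upper_moment n x p m i = (\<Sum>j\<in>{i<..n}. p j * (x j - m))"

context
  fixes n :: nat and x p :: "nat \<Rightarrow> real" and m :: real
  assumes p_pos: "\<forall>i\<in>{1..n}. p i > 0"
    and sum_p: "(\<Sum>i=1..n. p i) = 1"
    and mean_eq: "(\<Sum>i=1..n. p i * x i) = m"
begin

lemma head_mass_bounds:
  assumes "1 \<le> i" "i < n"
  shows "0 < head_mass p i" and "head_mass p i < 1"
    and "(\<Sum>j\<in>{i<..n}. p j) = 1 - head_mass p i"
proof -
  have "{1..n} = {1..i} \<union> {i<..n}" using assms by auto
  then have "(\<Sum>j=1..n. p j) = head_mass p i + (\<Sum>j\<in>{i<..n}. p j)"
    by (simp add: head_mass_def sum.union_disjoint ivl_disj_int)
  then show tail: "(\<Sum>j\<in>{i<..n}. p j) = 1 - head_mass p i" using sum_p by linarith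
  show "0 < head_mass p i"
    unfolding head_mass_def by (rule sum_pos) (use p_pos assms in auto)
  have "(\<Sum>j\<in>{i<..n}. p j) > 0" by (rule sum_pos) (use p_pos assms in auto)
  then show "head_mass p i < 1" unfolding tail by linarith
qed

lemma sum_centred: "(\<Sum>j=1..n. p j * (x j - m)) = 0"
proof -
  have "(\<Sum>j=1..n. p j * (x j - m)) = (\<Sum>j=1..n. p j * x j) - (\<Sum>j=1..n. p j) * m"
    by (simp add: right_diff_distrib sum_subtractf sum_distrib_right)
  then show ?thesis unfolding sum_p mean_eq by simp
qed

text \<open>The two sides have centred moments \<open>- S\<close> and \<open>S\<close> and masses
  \<open>P\<close> and \<open>1 - P\<close>. Compared with using the level \<open>m\<close>
  everywhere, the best levels save \<open>S^2 / P\<close> on the left and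
  \<open>S^2 / (1 - P)\<close> on the right, and the two fractions merge because the masses add up
  to 1.\<close>

lemma optimized_risk_eq:
  assumes "1 \<le> i" "i < n"
  shows "optimized_risk n x p i = (\<Sum>j=1..n. p j * (x j - m)\<^sup>2)
    - (upper_moment n x p m i)\<^sup>2 / (head_mass p i * (1 - head_mass p i))"
proof -
  \<comment> \<open>Completing the square in the level \<open>a\<close>: the excess over the optimum
    of a block is its mass times the squared distance of \<open>a\<close> from the block
    mean.\<close>
  have square: "(\<Sum>j\<in>A. p j * (x j - a)\<^sup>2) = (\<Sum>j\<in>A. p j * (x j - m)\<^sup>2)
    - (\<Sum>j\<in>A. p j * (x j - m))\<^sup>2 / sum p A
    + sum p A * (a - m - (\<Sum>j\<in>A. p j * (x j - m)) / sum p A)\<^sup>2"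
    if "sum p A \<noteq> 0" for A a
  proof -
    have "(\<Sum>j\<in>A. p j * (x j - a)\<^sup>2)
        = (\<Sum>j\<in>A. p j * (x j - m)\<^sup>2 - 2 * (a - m) * (p j * (x j - m)) + (a - m)\<^sup>2 * p j)"
      by (intro sum.cong refl) (simp add: algebra_simps power2_eq_square)
    also have "\<dots> = (\<Sum>j\<in>A. p j * (x j - m)\<^sup>2) - 2 * (a - m) * (\<Sum>j\<in>A. p j * (x j - m))
        + (a - m)\<^sup>2 * sum p A"
      by (simp add: sum.distrib sum_subtractf sum_distrib_left)
    also have "\<dots> = (\<Sum>j\<in>A. p j * (x j - m)\<^sup>2)
      - (\<Sum>j\<in>A. p j * (x j - m))\<^sup>2 / sum p A
      + sum p A * (a - m - (\<Sum>j\<in>A. p j * (x j - m)) / sum p A)\<^sup>2"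
      using that by (simp add: field_simps power2_eq_square)
    finally show ?thesis .
  qed
  have split: "(\<Sum>j=1..n. f j) = (\<Sum>j=1..i. f j) + (\<Sum>j\<in>{i<..n}. f j)"
    for f :: "nat \<Rightarrow> real"
  proof -
    have "{1..n} = {1..i} \<union> {i<..n}" using assms by auto
    then show ?thesis by (simp add: sum.union_disjoint ivl_disj_int)
  qed
  define P where "P = head_mass p i"
  define S where "S = upper_moment n x p m i"
  define V where "V = (\<Sum>j=1..n. p j * (x j - m)\<^sup>2)"
  have P: "0 < P" "P < 1"
    unfolding P_def by (rule head_mass_bounds(1,2)[OF assms])+
  have sums: "sum p {1..i} = P" "sum p {i<..n} = 1 - P"
    using head_mass_bounds(3)[OF assms] by (simp_all add: P_def head_mass_def)
  have moments: "(\<Sum>j=1..i. p j * (x j - m)) = - S" "(\<Sum>j\<in>{i<..n}. p j * (x j - m)) = S"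
    using split[of "\<lambda>j. p j * (x j - m)"] sum_centred by (simp_all add: S_def upper_moment_def)
  have "P * (1 - P) \<noteq> 0" using P by simp
  then have gain: "S\<^sup>2 / P + S\<^sup>2 / (1 - P) = S\<^sup>2 / (P * (1 - P))"
    by (simp add: divide_simps) (simp add: algebra_simps)
  have risk: "two_regime_risk n x p i a b = V - S\<^sup>2 / (P * (1 - P))
      + P * (a - m + S / P)\<^sup>2 + (1 - P) * (b - m - S / (1 - P))\<^sup>2" for a b
    unfolding two_regime_risk_def
    using square[of "{1..i}" a] square[of "{i<..n}" b] P
      split[of "\<lambda>j. p j * (x j - m)\<^sup>2"] gain
    unfolding sums moments V_def by simp
  have "optimized_risk n x p i = V - S\<^sup>2 / (P * (1 - P))"
    unfolding optimized_risk_def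
  proof (rule Least_equality)
    \<comment> \<open>The witnesses are the means of the two sides; they make both squares in
      \<open>risk\<close> vanish.\<close>
    show "\<exists>a b. V - S\<^sup>2 / (P * (1 - P)) = two_regime_risk n x p i a b"
      by (rule exI[of _ "m - S / P"], rule exI[of _ "m + S / (1 - P)"]) (simp add: risk)
  next
    fix w assume "\<exists>a b. w = two_regime_risk n x p i a b"
    then obtain a b where "w = two_regime_risk n x p i a b" by blast
    moreover have "P * (a - m + S / P)\<^sup>2 \<ge> 0" "(1 - P) * (b - m - S / (1 - P))\<^sup>2 \<ge> 0"
      using P by simp_all
    ultimately show "V - S\<^sup>2 / (P * (1 - P)) \<le> w" using risk[of a b] by linarith
  qed
  then show ?thesis by (simp add: P_def S_def V_def)
qed

section \<open>The signal as a difference of consecutive risks\<close>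

text \<open>The merging argument is replaced by a computation from the closed formula. Both gains
  and both numerators in the signal are expressed through four numbers: the mass \<open>P\<close> to
  the left of atom \<open>i\<close>, its weight \<open>q\<close>, its deviation \<open>y\<close>
  from the mean, and the moment \<open>S\<close> to its right.\<close>

lemma optimized_risk_step:
  assumes "1 < i" "i < n"
  shows "optimized_risk n x p (i - 1) - optimized_risk n x p i = p i * signal_D n x p i"
proof -
  define P where "P = head_mass p (i - 1)"
  define q where "q = p i"
  define S where "S = upper_moment n x p m i"
  define y where "y = x i - m"
  obtain l where l: "i = Suc l" "1 \<le> l" "l < n" "Suc l < n" using assms by (cases i) auto
  have P: "head_mass p (i - 1) = P" "head_mass p i = P + q"
    by (simp_all add: P_def q_def l head_mass_def)
  have bounds: "0 < P" "0 < q" "P + q < 1"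
    using head_mass_bounds(1)[OF l(2,3)] head_mass_bounds(2)[of i] bspec[OF p_pos, of i] P assms l
    by (simp_all add: P_def q_def)
  have "{l<..n} = insert i {i<..n}" using l by auto
  then have S': "upper_moment n x p m (i - 1) = S + q * y"
    by (simp add: S_def q_def y_def upper_moment_def l)
  have "(\<Sum>j\<in>{i<..n}. p j * (x j - x i))
      = (\<Sum>j\<in>{i<..n}. p j * (x j - m) - y * p j)"
    by (intro sum.cong) (auto simp: y_def algebra_simps)
  also have "\<dots> = S - y * (\<Sum>j\<in>{i<..n}. p j)"
    by (simp add: sum_subtractf S_def upper_moment_def sum_distrib_left)
  also have "(\<Sum>j\<in>{i<..n}. p j) = 1 - P - q"
    using head_mass_bounds(3)[of i] assms P by simp
  finally have A: "(\<Sum>j\<in>{i<..n}. p j * (x j - x i)) = S - y * (1 - P - q)" .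
  have "{1..n} = {1..l} \<union> {l<..n}" using l by auto
  then have "(\<Sum>j=1..l. p j * (x j - m)) = - (S + q * y)"
    using sum_centred S' by (simp add: sum.union_disjoint ivl_disj_int upper_moment_def l)
  moreover have "(\<Sum>j=1..<i. p j * (x i - x j)) = (\<Sum>j=1..l. y * p j - p j * (x j - m))"
    by (intro sum.cong) (auto simp: y_def l algebra_simps)
  moreover have "\<dots> = y * P - (\<Sum>j=1..l. p j * (x j - m))"
    by (simp add: sum_subtractf P_def head_mass_def sum_distrib_left l)
  ultimately have C: "(\<Sum>j=1..<i. p j * (x i - x j)) = y * P + (S + q * y)" by linarith
  have alg: "S\<^sup>2 / ((P + q) * (1 - (P + q))) - (S + q * y)\<^sup>2 / (P * (1 - P))
    = q * ((S - y * (1 - P - q))\<^sup>2 / ((1 - P) * (1 - (P + q)))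
           - (y * P + (S + q * y))\<^sup>2 / (P * (P + q)))"
  proof -
    define Q where "Q = P + q"
    define T where "T = 1 - P - q"
    have pos: "Q > 0" "T > 0" "T + q > 0" "P > 0" using bounds by (auto simp: Q_def T_def)
    have e: "1 - (P + q) = T" "1 - P = T + q" by (auto simp: T_def)
    have one: "P + q + T = 1" by (simp add: T_def)
    \<comment> \<open>This is the claim multiplied by \<open>P * (P + q) * T * (T + q)\<close>. The
      two sides have different degrees in the masses and agree only modulo
      \<open>P + q + T = 1\<close>.\<close>
    have "S\<^sup>2 * (P * (T + q)) - (S + q * y)\<^sup>2 * ((P + q) * T)
      = q * ((S - y * T)\<^sup>2 * (P * (P + q)) - (y * P + (S + q * y))\<^sup>2 * ((T + q) * T))"
      using one by algebra
    then show ?thesis unfolding e T_def[symmetric] using pos Q_def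
      by (simp add: divide_simps)
  qed
  have i: "1 \<le> i - 1" "i - 1 < n" "1 \<le> i" "i < n" using assms by auto
  have tail: "tail_mass n p i = 1 - P" "tail_mass n p (i + 1) = 1 - (P + q)"
    using head_mass_bounds(3)[OF i(1,2)] head_mass_bounds(3)[OF i(3,4)] P
    by (simp_all add: tail_mass_def l atLeastSucAtMost_greaterThanAtMost)
  \<comment> \<open>Nonnegative radicands, so that squaring removes the roots from the
    signal.\<close>
  have "0 \<le> (1 - P) * (1 - (P + q))" "0 \<le> P * (P + q)" using bounds by simp_all
  then have D: "signal_D n x p i = (S - y * (1 - P - q))\<^sup>2 / ((1 - P) * (1 - (P + q)))
      - (y * P + (S + q * y))\<^sup>2 / (P * (P + q))"
    unfolding signal_D_def signal_R_def signal_L_def A C tail P using assms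
    by (simp add: power_divide)
  show ?thesis
    using alg unfolding optimized_risk_eq[OF i(1,2)] optimized_risk_eq[OF i(3,4)]
      D P S' S_def[symmetric] q_def[symmetric] by linarith
qed

section \<open>Optimal cuts and the sign of the signal\<close>

text \<open>The guards say that the neighbouring cut exists. Necessity compares \<open>k\<close>
  with its neighbours. For sufficiency, monotonicity carries the sign at \<open>k\<close> to all
  interior atoms on the left and the sign at \<open>k + 1\<close> to all those on the right, and the
  resulting inequalities chain.\<close>

lemma optimal_cut_iff_signal:
  assumes anti: "antimono_on {1..n} (signal_D n x p)" and k: "1 \<le> k" "k < n"
  shows "optimal_cut n x p k \<longleftrightarrow>
    (1 < k \<longrightarrow> signal_D n x p k \<ge> 0) \<and> (k + 1 < n \<longrightarrow> signal_D n x p (k + 1) \<le> 0)"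
    (is "_ \<longleftrightarrow> ?D")
proof -
  let ?W = "optimized_risk n x p"
  have sgn: "?W j \<le> ?W (j - 1) \<longleftrightarrow> signal_D n x p j \<ge> 0"
    "?W (j - 1) \<le> ?W j \<longleftrightarrow> signal_D n x p j \<le> 0" if "1 < j" "j < n" for j
  proof -
    have "p j > 0" using p_pos that by simp
    then have "p j * signal_D n x p j \<ge> 0 \<longleftrightarrow> signal_D n x p j \<ge> 0"
      "p j * signal_D n x p j \<le> 0 \<longleftrightarrow> signal_D n x p j \<le> 0"
      by (simp_all add: zero_le_mult_iff mult_le_0_iff)
    then show "?W j \<le> ?W (j - 1) \<longleftrightarrow> signal_D n x p j \<ge> 0"
      "?W (j - 1) \<le> ?W j \<longleftrightarrow> signal_D n x p j \<le> 0"
      using optimized_risk_step[OF that] by linarith+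
  qed
  have "optimal_cut n x p k \<longleftrightarrow> ?W k = Min (?W ` {1..<n})"
    using k by (simp add: optimal_cut_def admissible_cut_def le_diff_conv2)
  also have "\<dots> \<longleftrightarrow> (\<forall>j\<in>{1..<n}. ?W k \<le> ?W j)"
    using k by (subst eq_commute, subst Min_eq_iff) auto
  also have "\<dots> \<longleftrightarrow> ?D"
  proof
    assume le: "\<forall>j\<in>{1..<n}. ?W k \<le> ?W j"
    have "signal_D n x p k \<ge> 0" if "1 < k"
    proof -
      have "k - 1 \<in> {1..<n}" using that k by auto
      then show ?thesis using sgn(1)[OF that k(2)] le by blast
    qed
    moreover have "signal_D n x p (k + 1) \<le> 0" if "k + 1 < n"
      using sgn(2)[of "k + 1"] bspec[OF le, of "k + 1"] that k by simp
    ultimately show ?D by blast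
  next
    assume D: ?D
    \<comment> \<open>The induction descends from \<open>k\<close> to \<open>j\<close>. A step is
      taken only if some cut lies to the left of \<open>k\<close>, so the guard \<open>1 < k\<close>
      is then satisfied.\<close>
    have falls: "?W k \<le> ?W j" if "j \<le> k" "1 \<le> j" for j
      using that
    proof (induction j rule: inc_induct)
      case (step i)
      have "signal_D n x p k \<le> signal_D n x p (Suc i)"
        using monotone_onD[OF anti, of "Suc i" k] step k by simp
      then have "?W (Suc i) \<le> ?W i"
        using assms D step sgn(1)[of "Suc i"]
        by simp
      then show ?case using step by simp
    qed simp
    have rises: "?W k \<le> ?W j" if "k \<le> j" "j < n" for j
      using that
    proof (induction j rule: dec_induct)
      case (step i)
      have "signal_D n x p (Suc i) \<le> signal_D n x p (k + 1)"
        using monotone_onD[OF anti, of "k + 1" "Suc i"] step k by simp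
      then have "?W i \<le> ?W (Suc i)"
        using assms D step sgn(2)[of "Suc i"]
        by simp
      then show ?case using step by simp
    qed simp
    show "\<forall>j\<in>{1..<n}. ?W k \<le> ?W j"
      using falls rises by (metis atLeastLessThan_iff nat_le_linear)
  qed
  finally show ?thesis .
qed

text \<open>An optimal \<open>i < k\<close> would have signal at most 0 at \<open>i + 1\<close>,
  while monotonicity makes it at least the positive value at \<open>k\<close>. An optimal
  \<open>i > k\<close> would have signal at least 0 at \<open>i\<close>, against the negative value
  at \<open>k + 1\<close>.\<close>

lemma optimal_cut_unique:
  assumes anti: "antimono_on {1..n} (signal_D n x p)" and k: "1 \<le> k" "k < n"
    and left: "1 < k \<Longrightarrow> signal_D n x p k > 0"
    and right: "k + 1 < n \<Longrightarrow> signal_D n x p (k + 1) < 0"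
  shows "{i. optimal_cut n x p i} = {k}"
proof -
  have "optimal_cut n x p k"
    using optimal_cut_iff_signal[OF anti k] left right by auto
  moreover have "i = k" if opt: "optimal_cut n x p i" for i
  proof (rule ccontr)
    assume "i \<noteq> k"
    have i: "1 \<le> i" "i < n"
      using conjunct1[OF opt[unfolded optimal_cut_def]] by (auto simp: admissible_cut_def)
    have D: "1 < i \<longrightarrow> signal_D n x p i \<ge> 0" "i + 1 < n \<longrightarrow> signal_D n x p (i + 1) \<le> 0"
      using optimal_cut_iff_signal[OF anti i] opt by auto
    show False
    proof (cases "i < k")
      case True
      then have "signal_D n x p k \<le> signal_D n x p (i + 1)"
        using monotone_onD[OF anti, of "i + 1" k] i k by auto
      then show False using D left True i k by auto
    next
      case False
      then have "signal_D n x p i \<le> signal_D n x p (k + 1)"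
        using monotone_onD[OF anti, of "k + 1" i] i k \<open>i \<noteq> k\<close> by auto
      then show False using D right False i k \<open>i \<noteq> k\<close> by auto
    qed
  qed
  ultimately show ?thesis by blast
qed

text \<open>The conventions that \<open>signal_L\<close> is 0 at the first atom and
  \<open>signal_R\<close> is 0 at the last give the signal a nonnegative first and a nonpositive
  last value. With zeros in between it is nonincreasing, and every cut passes the sign
  criterion.\<close>

lemma all_cuts_tied:
  assumes n: "n \<ge> 2" and zero: "\<And>i. 1 < i \<Longrightarrow> i < n \<Longrightarrow> signal_D n x p i = 0"
  shows "antimono_on {1..n} (signal_D n x p)" and "{i. optimal_cut n x p i} = {1..n - 1}"
proof -
  have D1: "signal_D n x p 1 \<ge> 0" by (simp add: signal_D_def signal_L_def)
  have Dn: "signal_D n x p n \<le> 0" by (simp add: signal_D_def signal_R_def)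
  show anti: "antimono_on {1..n} (signal_D n x p)"
  proof (rule monotone_onI)
    fix i j assume ij: "i \<in> {1..n}" "j \<in> {1..n}" "i \<le> j"
    have nonneg: "signal_D n x p i \<ge> 0" if "i < n"
      using D1 zero[of i] ij that by (cases "i = 1") auto
    have nonpos: "signal_D n x p j \<le> 0" if "1 < j"
      using Dn zero[of j] ij that by (cases "j = n") auto
    show "signal_D n x p i \<ge> signal_D n x p j"
    proof (cases "i = j")
      case False
      then have "i < n" "1 < j" using ij by auto
      then show ?thesis using nonneg nonpos by linarith
    qed simp
  qed
  have "optimal_cut n x p i" if "1 \<le> i" "i < n" for i
    using optimal_cut_iff_signal[OF anti that] zero[of i] zero[of "i + 1"] that by auto
  moreover have "1 \<le> i \<and> i \<le> n - 1" if "optimal_cut n x p i" for i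
    using conjunct1[OF that[unfolded optimal_cut_def]] by (simp add: admissible_cut_def)
  moreover have "1 \<le> i \<and> i \<le> n - 1 \<longleftrightarrow> 1 \<le> i \<and> i < n" for i using n by auto
  ultimately show "{i. optimal_cut n x p i} = {1..n - 1}"
    unfolding set_eq_iff mem_Collect_eq atLeastAtMost_iff by blast
qed

section \<open>The balanced cut against its two neighbours\<close>

text \<open>Equations between signs deliver the weak, the strict and the equality case together. The
  orientation flips because the signal at \<open>k\<close> has the sign of the neighbour's risk
  minus the balanced risk, whereas at \<open>k + 1\<close> the roles are exchanged.\<close>

lemma balanced_signal:
  assumes k: "1 \<le> k" "k < n" and half: "head_mass p k = 1 / 2"
    and d: "upper_moment n x p m k = d / 2" "0 < d" and gap: "x k < m" "m < x (k + 1)"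
  shows "1 < k \<Longrightarrow> sgn (signal_D n x p k) = sgn (mass_bound d (m - x k) - p k)"
    and "k + 1 < n \<Longrightarrow>
      sgn (signal_D n x p (k + 1)) = sgn (p (k + 1) - mass_bound d (x (k + 1) - m))"
proof -
  \<comment> \<open>The gain of a neighbouring cut: its sides have masses \<open>1 / 2 - q\<close>
    and \<open>1 / 2 + q\<close>. The formula does not depend on which side is the lighter one, so
    it serves both neighbours.\<close>
  define g where "g z q = (d / 2 - q * z)\<^sup>2 / ((1 / 2 - q) * (1 / 2 + q))" for z q :: real
  have gain: "sgn (d\<^sup>2 - g z q) = sgn (mass_bound d z - q)" if "0 < z" "0 < q" "q < 1 / 2" for z q
  proof -
    define c where "c = (1 / 2 - q) * (1 / 2 + q)"
    have c: "c > 0" using that by (simp add: c_def)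
    have s: "d\<^sup>2 + z\<^sup>2 > 0" using that d by (intro add_pos_pos) auto
    \<comment> \<open>The terms \<open>d^2 / 4\<close> cancel, which leaves the factor
      \<open>q\<close> and makes the comparison linear in \<open>q\<close>.\<close>
    have "d\<^sup>2 * c - (d / 2 - q * z)\<^sup>2 = q * (d * z - q * (d\<^sup>2 + z\<^sup>2))"
      by (simp add: c_def field_simps power2_eq_square)
    also have "d * z = mass_bound d z * (d\<^sup>2 + z\<^sup>2)"
      using s by (simp add: mass_bound_def)
    also have "q * (mass_bound d z * (d\<^sup>2 + z\<^sup>2) - q * (d\<^sup>2 + z\<^sup>2))
        = q * (d\<^sup>2 + z\<^sup>2) * (mass_bound d z - q)"
      by (simp add: algebra_simps)
    finally have diff: "d\<^sup>2 * c - (d / 2 - q * z)\<^sup>2 = q * (d\<^sup>2 + z\<^sup>2) * (mass_bound d z - q)" .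
    have "g z q = (d / 2 - q * z)\<^sup>2 / c" by (simp only: g_def c_def)
    then have "d\<^sup>2 - g z q = (d\<^sup>2 * c - (d / 2 - q * z)\<^sup>2) / c"
      using c by (simp add: diff_divide_distrib)
    then have "d\<^sup>2 - g z q = q * (d\<^sup>2 + z\<^sup>2) / c * (mass_bound d z - q)"
      unfolding diff by simp
    moreover have "sgn (q * (d\<^sup>2 + z\<^sup>2) / c) = 1" using c s that by (simp add: sgn_mult)
    ultimately show ?thesis by (simp only: sgn_mult mult_1_left)
  qed
  define V where "V = (\<Sum>j=1..n. p j * (x j - m)\<^sup>2)"
  have risk: "optimized_risk n x p k = V - d\<^sup>2"
    using optimized_risk_eq[OF k] half d by (simp add: V_def power_divide)
  have step: "sgn (signal_D n x p j) = sgn (optimized_risk n x p (j - 1) - optimized_risk n x p j)"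
    if "1 < j" "j < n" for j
    using optimized_risk_step[OF that] p_pos that by (simp add: sgn_mult)
  have moment: "upper_moment n x p m l = upper_moment n x p m (Suc l) + p (Suc l) * (x (Suc l) - m)"
    if "l < n" for l
  proof -
    have "{l<..n} = insert (Suc l) {Suc l<..n}" using that by auto
    then show ?thesis by (simp add: upper_moment_def)
  qed
  show "sgn (signal_D n x p k) = sgn (mass_bound d (m - x k) - p k)" if k': "1 < k"
  proof -
    obtain l where l: "k = Suc l" "1 \<le> l" "l < n" using k' k by (cases k) auto
    have P: "head_mass p l = 1 / 2 - p k" using half by (simp add: head_mass_def l)
    have S: "upper_moment n x p m l = d / 2 - p k * (m - x k)"
      using moment[OF l(3)] d by (simp add: l algebra_simps)
    have q: "0 < p k" "p k < 1 / 2"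
      using p_pos k head_mass_bounds(1)[OF l(2,3)] P by auto
    have "optimized_risk n x p l = V - g (m - x k) (p k)"
      using optimized_risk_eq[OF l(2,3)] P S by (simp add: V_def g_def)
    then show ?thesis
      using step[OF k' k(2)] gain[of "m - x k" "p k"] q gap risk by (simp add: l)
  qed
  show "sgn (signal_D n x p (k + 1)) = sgn (p (k + 1) - mass_bound d (x (k + 1) - m))"
    if "k + 1 < n"
  proof -
    have P: "head_mass p (k + 1) = 1 / 2 + p (k + 1)" using half by (simp add: head_mass_def)
    have S: "upper_moment n x p m (k + 1) = d / 2 - p (k + 1) * (x (k + 1) - m)"
      using moment[OF k(2)] d by (simp add: algebra_simps)
    have q: "0 < p (k + 1)" "p (k + 1) < 1 / 2"
      using p_pos head_mass_bounds(2)[of "k + 1"] P that by auto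
    have "optimized_risk n x p (k + 1) = V - g (x (k + 1) - m) (p (k + 1))"
      using optimized_risk_eq[of "k + 1"] that P S by (simp add: V_def g_def mult.commute)
    then have "sgn (signal_D n x p (k + 1)) = sgn (- (d\<^sup>2 - g (x (k + 1) - m) (p (k + 1))))"
      using step[of "k + 1"] that k risk by simp
    also have "\<dots> = sgn (- (mass_bound d (x (k + 1) - m) - p (k + 1)))"
      using gain[of "x (k + 1) - m" "p (k + 1)"] q gap by (simp only: sgn_minus diff_gt_0_iff_gt)
    finally show ?thesis by simp
  qed
qed

end

section \<open>Integrals and probabilities under a finite law\<close>

text \<open>The events \<open>X = x i\<close> are disjoint and their probabilities sum to 1, so they
  cover almost every outcome. Hence \<open>g (X \<omega>)\<close> agrees almost everywhere with a
  finite combination of indicators.\<close>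

lemma has_finite_law_integral:
  fixes g :: "real \<Rightarrow> real"
  assumes law: "has_finite_law M X n x p" and g: "g \<in> borel_measurable borel"
  shows "integral\<^sup>L M (\<lambda>\<omega>. g (X \<omega>)) = (\<Sum>i=1..n. p i * g (x i))"
proof -
  have D: "prob_space M" "X \<in> borel_measurable M" "strict_mono_on {1..n} x"
    "\<forall>i\<in>{1..n}. p i = measure M {\<omega> \<in> space M. X \<omega> = x i} \<and> p i > 0" "(\<Sum>i=1..n. p i) = 1"
    using law unfolding has_finite_law_def by blast+
  interpret prob_space M by (rule D(1))
  note [measurable] = D(2)
  note [measurable] = g
  have inj: "inj_on x {1..n}"
    by (rule strict_mono_on_imp_inj_on[OF D(3)])
  define E where "E i = {\<omega> \<in> space M. X \<omega> = x i}" for i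
  have E[measurable]: "E i \<in> events" for i unfolding E_def by measurable
  have pE: "prob (E i) = p i" if "i \<in> {1..n}" for i
    using bspec[OF D(4) that] by (simp add: E_def)
  have "E i \<inter> E j = {}" if "i \<in> {1..n}" "j \<in> {1..n}" "i \<noteq> j" for i j
    using inj_on_eq_iff[OF inj that(1,2)] that(3) by (auto simp: E_def)
  then have "prob (\<Union>i\<in>{1..n}. E i) = (\<Sum>i=1..n. prob (E i))"
    by (intro finite_measure_finite_Union) (auto simp: disjoint_family_on_def)
  also have "\<dots> = 1" using D(5) pE by simp
  finally have "AE \<omega> in M. \<omega> \<in> (\<Union>i\<in>{1..n}. E i)"
    by (subst (asm) prob_eq_1) auto
  then have "AE \<omega> in M. g (X \<omega>) = (\<Sum>i=1..n. g (x i) * indicator (E i) \<omega>)"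
  proof eventually_elim
    case (elim \<omega>)
    then obtain i where i: "i \<in> {1..n}" "\<omega> \<in> E i" by auto
    have "(\<Sum>j=1..n. g (x j) * indicator (E j) \<omega>) = (\<Sum>j=1..n. if j = i then g (x i) else 0)"
      using i inj_on_eq_iff[OF inj i(1)] by (intro sum.cong) (auto simp: E_def)
    then show ?case using i by (auto simp: E_def)
  qed
  then have "integral\<^sup>L M (\<lambda>\<omega>. g (X \<omega>))
      = integral\<^sup>L M (\<lambda>\<omega>. \<Sum>i=1..n. g (x i) * indicator (E i) \<omega>)"
    by (intro integral_cong_AE) measurable
  also have "\<dots> = (\<Sum>i=1..n. g (x i) * prob (E i))"
    by (subst Bochner_Integration.integral_sum) (auto simp: less_top[symmetric])
  finally show ?thesis using pE by (simp add: mult.commute)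
qed

lemma has_finite_lawD:
  assumes "has_finite_law M X n x p"
  shows "\<forall>i\<in>{1..n}. p i > 0" "(\<Sum>i=1..n. p i) = 1" "(\<Sum>i=1..n. p i * x i) = mean M X"
proof -
  show "\<forall>i\<in>{1..n}. p i > 0" "(\<Sum>i=1..n. p i) = 1"
    using assms unfolding has_finite_law_def by blast+
  show "(\<Sum>i=1..n. p i * x i) = mean M X"
    using has_finite_law_integral[OF assms, of "\<lambda>t. t"] by simp
qed

text \<open>The restriction to an open half-line \<open>S\<close> is absorbed into the integrand
  \<open>indicator S t * g t\<close>. Since \<open>c\<close> lies between two consecutive atoms, the
  indicator is 1 at all atoms on one side of the gap and 0 at all the others.\<close>

lemma has_finite_law_gap_integral:
  fixes g :: "real \<Rightarrow> real"
  assumes law: "has_finite_law M X n x p" and k: "1 \<le> k" "k < n" "x k < c" "c < x (k + 1)"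
    and g[measurable]: "g \<in> borel_measurable borel"
  shows "(LINT \<omega>:{\<omega> \<in> space M. X \<omega> < c}|M. g (X \<omega>)) = (\<Sum>j=1..k. p j * g (x j))"
    and "(LINT \<omega>:{\<omega> \<in> space M. X \<omega> > c}|M. g (X \<omega>)) = (\<Sum>j\<in>{k<..n}. p j * g (x j))"
proof -
  have "strict_mono_on {1..n} x" using law by (simp add: has_finite_law_def)
  note mono = strict_mono_on_leD[OF this]
  have below: "x i < c" if "i \<in> {1..k}" for i using mono[of i k] that k by auto
  have above: "c < x i" if "i \<in> {k<..n}" for i using mono[of "k + 1" i] that k by auto
  have split: "(\<Sum>j=1..n. p j * f (x j))
      = (\<Sum>j=1..k. p j * f (x j)) + (\<Sum>j\<in>{k<..n}. p j * f (x j))"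
    for f :: "real \<Rightarrow> real"
  proof -
    have "{1..n} = {1..k} \<union> {k<..n}" using k by auto
    then show ?thesis by (simp add: sum.union_disjoint ivl_disj_int)
  qed
  have set: "(LINT \<omega>:{\<omega> \<in> space M. X \<omega> \<in> S}|M. g (X \<omega>))
      = (\<Sum>j=1..n. p j * (indicator S (x j) * g (x j)))"
    if [measurable]: "S \<in> sets borel" for S
  proof -
    have "(LINT \<omega>:{\<omega> \<in> space M. X \<omega> \<in> S}|M. g (X \<omega>))
        = (LINT \<omega>|M. indicator S (X \<omega>) * g (X \<omega>))"
      unfolding set_lebesgue_integral_def
      by (intro Bochner_Integration.integral_cong) (auto simp: indicator_def)
    also have "\<dots> = (\<Sum>j=1..n. p j * (indicator S (x j) * g (x j)))"
      by (rule has_finite_law_integral[OF law, of "\<lambda>t. indicator S t * g t"]) measurable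
    finally show ?thesis .
  qed
  have ind_below: "indicator {..<c} (x i) = (1 :: real)" "indicator {c<..} (x i) = (0 :: real)"
    if "i \<in> {1..k}" for i
    using below[OF that] by simp_all
  have ind_above: "indicator {..<c} (x i) = (0 :: real)" "indicator {c<..} (x i) = (1 :: real)"
    if "i \<in> {k<..n}" for i
    using above[OF that] by simp_all
  have "(\<Sum>j=1..k. p j * (indicator {..<c} (x j) * g (x j))) = (\<Sum>j=1..k. p j * g (x j))"
    by (intro sum.cong refl) (simp only: ind_below mult_1)
  moreover have "(\<Sum>j\<in>{k<..n}. p j * (indicator {..<c} (x j) * g (x j))) = 0"
    by (intro sum.neutral ballI) (simp only: ind_above mult_zero_left mult_zero_right)
  ultimately show "(LINT \<omega>:{\<omega> \<in> space M. X \<omega> < c}|M. g (X \<omega>)) = (\<Sum>j=1..k. p j * g (x j))"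
    using set[of "{..<c}"] split[of "\<lambda>t. indicator {..<c} t * g t"] by simp
  have "(\<Sum>j=1..k. p j * (indicator {c<..} (x j) * g (x j))) = 0"
    by (intro sum.neutral ballI) (simp only: ind_below mult_zero_left mult_zero_right)
  moreover have "(\<Sum>j\<in>{k<..n}. p j * (indicator {c<..} (x j) * g (x j)))
      = (\<Sum>j\<in>{k<..n}. p j * g (x j))"
    by (intro sum.cong refl) (simp only: ind_above mult_1)
  ultimately show "(LINT \<omega>:{\<omega> \<in> space M. X \<omega> > c}|M. g (X \<omega>)) = (\<Sum>j\<in>{k<..n}. p j * g (x j))"
    using set[of "{c<..}"] split[of "\<lambda>t. indicator {c<..} t * g t"] by simp
qed

lemma gap_measure:
  assumes law: "has_finite_law M X n x p" and k: "1 \<le> k" "k < n" "x k < c" "c < x (k + 1)"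
  shows "measure M {\<omega> \<in> space M. X \<omega> < c} = (\<Sum>j=1..k. p j)"
    and "measure M {\<omega> \<in> space M. X \<omega> > c} = (\<Sum>j\<in>{k<..n}. p j)"
  using has_finite_law_gap_integral[OF law k, of "\<lambda>_. 1"]
  by (simp_all add: set_lebesgue_integral_def Int_absorb2 subset_iff)

lemma balanced_deviation:
  assumes law: "has_finite_law M X n x p" and bal: "balanced_mean_gap M X n x k"
  shows "upper_deviation M X = 2 * (\<Sum>j\<in>{k<..n}. p j * (x j - mean M X))"
    and "lower_deviation M X = 2 * (\<Sum>j=1..k. p j * (mean M X - x j))"
proof -
  have k: "1 \<le> k" "k < n" "x k < mean M X" "mean M X < x (k + 1)"
    and half: "measure M {\<omega> \<in> space M. X \<omega> < mean M X} = 1 / 2"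
      "measure M {\<omega> \<in> space M. X \<omega> > mean M X} = 1 / 2"
    using bal by (auto simp: balanced_mean_gap_def)
  note gap = has_finite_law_gap_integral[OF law k]
  show "upper_deviation M X = 2 * (\<Sum>j\<in>{k<..n}. p j * (x j - mean M X))"
    unfolding upper_deviation_def event_expectation_def half
    using gap(2)[of "\<lambda>t. t - mean M X"] by simp
  show "lower_deviation M X = 2 * (\<Sum>j=1..k. p j * (mean M X - x j))"
    unfolding lower_deviation_def event_expectation_def half
    using gap(1)[of "\<lambda>t. mean M X - t"] by simp
qed

section \<open>Realizing prescribed atoms and weights\<close>

text \<open>Provides the measures for the two tied examples: the identity on the reals under the
  discrete distribution that lists the atoms with their weights.\<close>

lemma has_finite_law_exists:
  fixes x p :: "nat \<Rightarrow> real"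
  assumes n: "n \<ge> 2" and x: "strict_mono_on {1..n} x"
    and p: "\<And>i. i \<in> {1..n} \<Longrightarrow> p i > 0" and sum: "(\<Sum>i=1..n. p i) = 1"
  shows "\<exists>M :: real measure. has_finite_law M (\<lambda>\<omega>. \<omega>) n x p"
proof -
  have inj: "inj_on x {1..n}" using x by (rule strict_mono_on_imp_inj_on)
  define xs where "xs = map (\<lambda>i. (x i, p i)) [1..<Suc n]"
  have "sum_list (map snd xs) = (\<Sum>i=1..n. p i)"
    by (simp add: xs_def o_def interv_sum_list_conv_sum_set_nat
        atLeastLessThanSuc_atLeastAtMost del: upt_Suc)
  then have wf: "pmf_of_list_wf xs"
    using p sum by (auto simp: pmf_of_list_wf_def xs_def less_imp_le simp del: upt_Suc)
  have "measure (measure_pmf (pmf_of_list xs)) {\<omega>. \<omega> = x i} = p i" if i: "i \<in> {1..n}" for i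
  proof -
    have "measure (measure_pmf (pmf_of_list xs)) {\<omega>. \<omega> = x i} = pmf (pmf_of_list xs) (x i)"
      by (simp add: pmf.rep_eq)
    also have "\<dots> = sum_list (map snd (filter (\<lambda>z. fst z = x i) xs))"
      using wf by (rule pmf_pmf_of_list)
    also have "\<dots> = (\<Sum>j=1..n. if x j = x i then p j else 0)"
      by (simp add: sum_list_map_filter' xs_def o_def interv_sum_list_conv_sum_set_nat
          atLeastLessThanSuc_atLeastAtMost cong: if_cong del: upt_Suc)
    \<comment> \<open>The atoms are distinct, so exactly one list entry carries the value
      \<open>x i\<close>.\<close>
    also have "\<dots> = (\<Sum>j=1..n. if j = i then p j else 0)"
      using inj_on_eq_iff[OF inj _ i] by (intro sum.cong) auto
    also have "\<dots> = p i" using i by simp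
    finally show ?thesis .
  qed
  then have "has_finite_law (measure_pmf (pmf_of_list xs)) (\<lambda>\<omega>. \<omega>) n x p"
    using n x p sum by (auto simp: has_finite_law_def measure_pmf.prob_space_axioms)
  then show ?thesis by blast
qed

section \<open>Criterion, uniqueness, ties, and two laws with a larger tied block\<close>

theorem theorem4p2:
  fixes M :: "'a measure" and X :: "'a \<Rightarrow> real"
    and n k :: nat and x p :: "nat \<Rightarrow> real"
  shows
    "(has_finite_law M X n x p \<and> balanced_mean_gap M X n x k \<and>
      antimono_on {1..n} (signal_D n x p) \<longrightarrow>
        upper_deviation M X = lower_deviation M X \<and>
        (optimal_cut n x p k \<longleftrightarrow>
           (admissible_cut n (k - 1) \<longrightarrow> p k \<le> left_bound M X x k) \<and>
           (admissible_cut n (k + 1) \<longrightarrow> p (k + 1) \<le> right_bound M X x k)) \<and>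
        ((admissible_cut n (k - 1) \<longrightarrow> p k < left_bound M X x k) \<and>
         (admissible_cut n (k + 1) \<longrightarrow> p (k + 1) < right_bound M X x k) \<and>
         strict_antimono_on {1..n} (signal_D n x p) \<longrightarrow>
           {i. optimal_cut n x p i} = {k}) \<and>
        (admissible_cut n (k - 1) \<and> p k = left_bound M X x k \<longrightarrow>
           optimal_cut n x p k \<and> optimal_cut n x p (k - 1)) \<and>
        (admissible_cut n (k + 1) \<and> p (k + 1) = right_bound M X x k \<longrightarrow>
           optimal_cut n x p k \<and> optimal_cut n x p (k + 1)))
     \<and>
     (\<exists>(M' :: real measure) X' n' x' p' k' l.
        has_finite_law M' X' n' x' p' \<and> balanced_mean_gap M' X' n' x' k' \<and>
        antimono_on {1..n'} (signal_D n' x' p') \<and>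
        admissible_cut n' (k' - 1) \<and> p' k' = left_bound M' X' x' k' \<and>
        {i. optimal_cut n' x' p' i} = {l..k'} \<and> {k' - 1, k'} \<subset> {l..k'})
     \<and>
     (\<exists>(M' :: real measure) X' n' x' p' k' l.
        has_finite_law M' X' n' x' p' \<and> balanced_mean_gap M' X' n' x' k' \<and>
        antimono_on {1..n'} (signal_D n' x' p') \<and>
        admissible_cut n' (k' + 1) \<and> p' (k' + 1) = right_bound M' X' x' k' \<and>
        {i. optimal_cut n' x' p' i} = {k'..l} \<and> {k', k' + 1} \<subset> {k'..l})"
proof (rule conjI[OF impI conjI], elim conjE)
  assume law: "has_finite_law M X n x p" and bal: "balanced_mean_gap M X n x k"
    and anti: "antimono_on {1..n} (signal_D n x p)"
  note law_facts = has_finite_lawD[OF law]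
  have k: "1 \<le> k" "k < n" and gap: "x k < mean M X" "mean M X < x (k + 1)"
    using bal by (auto simp: balanced_mean_gap_def)
  have half: "head_mass p k = 1 / 2"
    using gap_measure(1)[OF law k gap] bal by (simp add: balanced_mean_gap_def head_mass_def)
  define d where "d = upper_deviation M X"
  have d: "upper_moment n x p (mean M X) k = d / 2"
    using balanced_deviation(1)[OF law bal] by (simp add: d_def upper_moment_def)
  have "strict_mono_on {1..n} x" using law by (simp add: has_finite_law_def)
  then have "x (k + 1) \<le> x j" if "j \<in> {k<..n}" for j
    using strict_mono_on_leD[of "{1..n}" x "k + 1" j] that k by auto
  then have "mean M X < x j" if "j \<in> {k<..n}" for j using gap that by fastforce
  then have "upper_moment n x p (mean M X) k > 0"
    unfolding upper_moment_def using k law_facts(1) by (intro sum_pos) auto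
  then have d_pos: "d > 0" using d by simp
  have left: "left_bound M X x k = mass_bound d (mean M X - x k)"
    and right: "right_bound M X x k = mass_bound d (x (k + 1) - mean M X)"
    by (simp_all add: left_bound_def right_bound_def d_def)
  have sgn_eq: "(a \<ge> 0 \<longleftrightarrow> b \<ge> 0) \<and> (a > 0 \<longleftrightarrow> b > 0) \<and> (a \<le> 0 \<longleftrightarrow> b \<le> 0) \<and> (a < 0 \<longleftrightarrow> b < 0)"
    if "sgn a = sgn b" for a b :: real
    using that by (auto simp: sgn_if split: if_splits)
  have left_signal: "signal_D n x p k \<ge> 0 \<longleftrightarrow> p k \<le> left_bound M X x k"
      "signal_D n x p k > 0 \<longleftrightarrow> p k < left_bound M X x k" if "1 < k"
    using sgn_eq[OF balanced_signal(1)[OF law_facts k half d d_pos gap that]]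
    unfolding left by simp_all
  have right_signal: "signal_D n x p (k + 1) \<le> 0 \<longleftrightarrow> p (k + 1) \<le> right_bound M X x k"
      "signal_D n x p (k + 1) < 0 \<longleftrightarrow> p (k + 1) < right_bound M X x k" if "k + 1 < n"
    using sgn_eq[OF balanced_signal(2)[OF law_facts k half d d_pos gap that]]
    unfolding right by simp_all
  \<comment> \<open>For \<open>k = 1\<close> the difference \<open>k - 1\<close> is 0, which is not
    an admissible cut, so admissibility matches the guards of the sign criterion.\<close>
  have adm: "admissible_cut n (k - 1) \<longleftrightarrow> 1 < k" "admissible_cut n (k + 1) \<longleftrightarrow> k + 1 < n"
    using k by (auto simp: admissible_cut_def)
  note opt = optimal_cut_iff_signal[OF law_facts anti]
  note decreasing = monotone_onD[OF anti]
  \<comment> \<open>Both halves have mass 1/2, so the vanishing of the total centred moment equates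
    the two conditional deviations.\<close>
  have "(\<Sum>j=1..n. p j * (x j - mean M X)) = 0"
    by (rule sum_centred[OF law_facts])
  moreover have "{1..n} = {1..k} \<union> {k<..n}" using k by auto
  moreover have "(\<Sum>j=1..k. p j * (mean M X - x j)) = - (\<Sum>j=1..k. p j * (x j - mean M X))"
    by (simp add: sum_negf[symmetric] algebra_simps)
  ultimately have deviations: "upper_deviation M X = lower_deviation M X"
    using balanced_deviation[OF law bal] by (simp add: sum.union_disjoint ivl_disj_int)
  have criterion: "optimal_cut n x p k \<longleftrightarrow>
           (admissible_cut n (k - 1) \<longrightarrow> p k \<le> left_bound M X x k) \<and>
           (admissible_cut n (k + 1) \<longrightarrow> p (k + 1) \<le> right_bound M X x k)"
    unfolding adm opt[OF k] using left_signal(1) right_signal(1) by blast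
  have unique: "{i. optimal_cut n x p i} = {k}"
    if "admissible_cut n (k - 1) \<longrightarrow> p k < left_bound M X x k"
      "admissible_cut n (k + 1) \<longrightarrow> p (k + 1) < right_bound M X x k"
    using that left_signal(2) right_signal(2) unfolding adm
    by (intro optimal_cut_unique[OF law_facts anti k]) auto
  \<comment> \<open>Equality means that the signal vanishes at \<open>k\<close>. By monotonicity it
    is nonpositive at \<open>k + 1\<close> and nonnegative at \<open>k - 1\<close>, so the sign
    criterion holds at \<open>k\<close> and at \<open>k - 1\<close>.\<close>
  have left_tie: "optimal_cut n x p k" "optimal_cut n x p (k - 1)"
    if a: "admissible_cut n (k - 1)" and eq: "p k = left_bound M X x k"
  proof -
    have k': "1 < k" using a adm by simp
    have D: "signal_D n x p k = 0" using left_signal[OF k'] eq by linarith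
    have "k + 1 < n \<Longrightarrow> signal_D n x p (k + 1) \<le> 0"
      using decreasing[of k "k + 1"] k D by auto
    then show "optimal_cut n x p k" using opt[OF k] D by simp
    have "k - 1 \<in> {1..n}" "k \<in> {1..n}" using k k' by auto
    then have "signal_D n x p (k - 1) \<ge> 0"
      using decreasing[of "k - 1" k] D by simp
    then show "optimal_cut n x p (k - 1)" using opt[of "k - 1"] D k' k by auto
  qed
  \<comment> \<open>Here the zero is at \<open>k + 1\<close>, which forces the signal to be
    nonnegative at \<open>k\<close> and, if that atom is interior, nonpositive at
    \<open>k + 2\<close>.\<close>
  have right_tie: "optimal_cut n x p k" "optimal_cut n x p (k + 1)"
    if a: "admissible_cut n (k + 1)" and eq: "p (k + 1) = right_bound M X x k"
  proof -
    have k': "k + 1 < n" using a adm by simp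
    have D: "signal_D n x p (k + 1) = 0" using right_signal[OF k'] eq by linarith
    have "signal_D n x p k \<ge> 0"
      using decreasing[of k "k + 1"] k k' D by auto
    then show "optimal_cut n x p k" using opt[OF k] D by simp
    have "k + 2 < n \<Longrightarrow> signal_D n x p (k + 2) \<le> 0"
      using decreasing[of "k + 1" "k + 2"] k k' D by auto
    then show "optimal_cut n x p (k + 1)" using opt[of "k + 1"] D k' by auto
  qed
  show "upper_deviation M X = lower_deviation M X \<and>
        (optimal_cut n x p k \<longleftrightarrow>
           (admissible_cut n (k - 1) \<longrightarrow> p k \<le> left_bound M X x k) \<and>
           (admissible_cut n (k + 1) \<longrightarrow> p (k + 1) \<le> right_bound M X x k)) \<and>
        ((admissible_cut n (k - 1) \<longrightarrow> p k < left_bound M X x k) \<and>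
         (admissible_cut n (k + 1) \<longrightarrow> p (k + 1) < right_bound M X x k) \<and>
         strict_antimono_on {1..n} (signal_D n x p) \<longrightarrow>
           {i. optimal_cut n x p i} = {k}) \<and>
        (admissible_cut n (k - 1) \<and> p k = left_bound M X x k \<longrightarrow>
           optimal_cut n x p k \<and> optimal_cut n x p (k - 1)) \<and>
        (admissible_cut n (k + 1) \<and> p (k + 1) = right_bound M X x k \<longrightarrow>
           optimal_cut n x p k \<and> optimal_cut n x p (k + 1))"
    by (rule conjI[OF deviations conjI[OF criterion conjI[OF impI conjI[OF impI impI]]]]; elim conjE)
      ((rule unique; assumption) | (rule conjI; rule left_tie; assumption)
       | (rule conjI; rule right_tie; assumption))+
next
  show "\<exists>(M' :: real measure) X' n' x' p' k' l.
        has_finite_law M' X' n' x' p' \<and> balanced_mean_gap M' X' n' x' k' \<and>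
        antimono_on {1..n'} (signal_D n' x' p') \<and>
        admissible_cut n' (k' - 1) \<and> p' k' = left_bound M' X' x' k' \<and>
        {i. optimal_cut n' x' p' i} = {l..k'} \<and> {k' - 1, k'} \<subset> {l..k'}"
  proof -
    \<comment> \<open>The leading 0 fills the index 0. The mean is 0 and the balanced cut is 3, with
      \<open>d = 3\<close> and distance 1, so the left bound is 3 / (9 + 1), the weight of atom 3.
      The cuts 1, 2, 3 have gains 0.81 / 0.09, 1.44 / 0.16 and 2.25 / 0.25, all equal to 9.\<close>
    define x p :: "nat \<Rightarrow> real" where "x = (!) [0, -9, -3, -1, 3]"
      and "p = (!) [0, 1/10, 1/10, 3/10, 1/2]"
    have four: "{1..4} = {1, 2, 3, 4 :: nat}" by auto
    have vals: "x 1 = -9" "x 2 = -3" "x 3 = -1" "x 4 = 3"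
      "p 1 = 1/10" "p 2 = 1/10" "p 3 = 3/10" "p 4 = 1/2"
      by (simp_all add: x_def p_def)
    have "strict_mono_on {1..4} x"
      unfolding four by (rule strict_mono_onI) (auto simp: vals simp del: One_nat_def)
    then obtain M :: "real measure" where law: "has_finite_law M (\<lambda>\<omega>. \<omega>) 4 x p"
      using has_finite_law_exists[of 4 x p] unfolding four
      by (fastforce simp: vals simp del: One_nat_def)
    note law_facts = has_finite_lawD[OF law]
    have mean: "mean M (\<lambda>\<omega>. \<omega>) = 0"
      using law_facts(3) by (simp add: four vals del: One_nat_def)
    have sets: "{1..1} = {1::nat}" "{1..2} = {1, 2::nat}" "{1..3} = {1, 2, 3::nat}"
      "{1..<2} = {1::nat}" "{1..<3} = {1, 2::nat}" "{2<..4} = {3, 4::nat}" "{3<..4} = {4::nat}"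
      "{2..4} = {2, 3, 4::nat}" "{3..4} = {3, 4::nat}" "{4..4} = {4::nat}"
      by auto
    have bal: "balanced_mean_gap M (\<lambda>\<omega>. \<omega>) 4 x 3"
      using gap_measure[OF law, of 3 0]
      by (simp add: balanced_mean_gap_def mean vals head_mass_def tail_mass_def sets del: One_nat_def)
    \<comment> \<open>Both squared signals equal 18 at atom 2 and 10 at atom 3.\<close>
    have "signal_D 4 x p 2 = 0" "signal_D 4 x p 3 = 0"
      by (simp_all add: signal_D_def signal_R_def signal_L_def head_mass_def tail_mass_def sets vals
          vals(1,5)[unfolded One_nat_def] power_divide del: One_nat_def)
    moreover have "i = 2 \<or> i = 3" if "1 < i" "i < 4" for i :: nat using that by linarith
    ultimately have zero: "signal_D 4 x p i = 0" if "1 < i" "i < 4" for i using that by blast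
    have tied: "antimono_on {1..4} (signal_D 4 x p)" "{i. optimal_cut 4 x p i} = {1..3}"
      using all_cuts_tied[OF law_facts _ zero] by simp_all
    have "p 3 = left_bound M (\<lambda>\<omega>. \<omega>) x 3"
      using balanced_deviation(1)[OF law bal]
      by (simp add: left_bound_def mass_bound_def mean vals sets)
    moreover have "admissible_cut 4 (3 - 1)" by (simp add: admissible_cut_def)
    moreover have "{3 - 1, 3} \<subseteq> {1..3::nat}" "1 \<in> {1..3::nat} - {3 - 1, 3}" by simp_all
    then have "{3 - 1, 3} \<subset> {1..3::nat}" by blast
    ultimately show ?thesis
      using law bal tied
      by - (rule exI[of _ M], rule exI[of _ "\<lambda>\<omega>. \<omega>"], rule exI[of _ 4], rule exI[of _ x],
          rule exI[of _ p], rule exI[of _ 3], rule exI[of _ 1], intro conjI)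
  qed
next
  show "\<exists>(M' :: real measure) X' n' x' p' k' l.
        has_finite_law M' X' n' x' p' \<and> balanced_mean_gap M' X' n' x' k' \<and>
        antimono_on {1..n'} (signal_D n' x' p') \<and>
        admissible_cut n' (k' + 1) \<and> p' (k' + 1) = right_bound M' X' x' k' \<and>
        {i. optimal_cut n' x' p' i} = {k'..l} \<and> {k', k' + 1} \<subset> {k'..l}"
  proof -
    \<comment> \<open>The previous law reflected at 0: atom \<open>i\<close> becomes atom
      \<open>5 - i\<close> and the roles of \<open>signal_L\<close> and \<open>signal_R\<close> are
      exchanged. The balanced cut is now 1, and the bound 3/10 is attained by atom 2.\<close>
    define x p :: "nat \<Rightarrow> real" where "x = (!) [0, -3, 1, 3, 9]"
      and "p = (!) [0, 1/2, 3/10, 1/10, 1/10]"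
    have four: "{1..4} = {1, 2, 3, 4 :: nat}" by auto
    have vals: "x 1 = -3" "x 2 = 1" "x 3 = 3" "x 4 = 9"
      "p 1 = 1/2" "p 2 = 3/10" "p 3 = 1/10" "p 4 = 1/10"
      by (simp_all add: x_def p_def)
    have "strict_mono_on {1..4} x"
      unfolding four by (rule strict_mono_onI) (auto simp: vals simp del: One_nat_def)
    then obtain M :: "real measure" where law: "has_finite_law M (\<lambda>\<omega>. \<omega>) 4 x p"
      using has_finite_law_exists[of 4 x p] unfolding four
      by (fastforce simp: vals simp del: One_nat_def)
    note law_facts = has_finite_lawD[OF law]
    have mean: "mean M (\<lambda>\<omega>. \<omega>) = 0"
      using law_facts(3) by (simp add: four vals del: One_nat_def)
    have sets: "{1..1} = {1::nat}" "{1..2} = {1, 2::nat}" "{1..3} = {1, 2, 3::nat}"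
      "{1..<2} = {1::nat}" "{1..<3} = {1, 2::nat}" "{2<..4} = {3, 4::nat}" "{3<..4} = {4::nat}"
      "{1<..4} = {2, 3, 4::nat}"
      "{2..4} = {2, 3, 4::nat}" "{3..4} = {3, 4::nat}" "{4..4} = {4::nat}"
      by auto
    have two: "1 + 1 = (2::nat)" by simp
    have bal: "balanced_mean_gap M (\<lambda>\<omega>. \<omega>) 4 x 1"
      using gap_measure[OF law, of 1 0]
      by (simp add: balanced_mean_gap_def mean two vals head_mass_def tail_mass_def sets
          del: One_nat_def)
    have "signal_D 4 x p 2 = 0" "signal_D 4 x p 3 = 0"
      by (simp_all add: signal_D_def signal_R_def signal_L_def head_mass_def tail_mass_def sets vals
          vals(1,5)[unfolded One_nat_def] power_divide del: One_nat_def)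
    moreover have "i = 2 \<or> i = 3" if "1 < i" "i < 4" for i :: nat using that by linarith
    ultimately have zero: "signal_D 4 x p i = 0" if "1 < i" "i < 4" for i using that by blast
    have tied: "antimono_on {1..4} (signal_D 4 x p)" "{i. optimal_cut 4 x p i} = {1..3}"
      using all_cuts_tied[OF law_facts _ zero] by simp_all
    have "p (1 + 1) = right_bound M (\<lambda>\<omega>. \<omega>) x 1"
      using balanced_deviation(1)[OF law bal]
      by (simp add: right_bound_def mass_bound_def mean two vals sets del: One_nat_def)
    moreover have "admissible_cut 4 (1 + 1)" by (simp add: admissible_cut_def)
    moreover have "{1, 1 + 1} \<subseteq> {1..3::nat}" "3 \<in> {1..3::nat} - {1, 1 + 1}" by simp_all
    then have "{1, 1 + 1} \<subset> {1..3::nat}" by blast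
    ultimately show ?thesis
      using law bal tied
      by - (rule exI[of _ M], rule exI[of _ "\<lambda>\<omega>. \<omega>"], rule exI[of _ 4], rule exI[of _ x],
          rule exI[of _ p], rule exI[of _ 1], rule exI[of _ 3], intro conjI)
  qed
qed

end
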